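(* Let $\Lambda$ be a subset of $\mathbb{R}$ with $0\in\Lambda$. Then $\{e_\lambda : \lambda\in\Lambda\}$ is a maximal set of mutually orthogonal exponentials in $L^2(\mu_4)$ if and only if there exists a spectral labeling $\mathcal L$ of the infinite binary tree such that $\Lambda=\Lambda(\mathcal L)$.
   Context: Measure. $\mu_4$ is the unique Borel probability measure on $\mathbb{R}$ satisfying $\int f(x)\,d\mu_4(x)=\frac12\left(\int f(\tfrac{x}{4})\,d\mu_4(x)+\int f(\tfrac{x+2}{4})\,d\mu_4(x)\right)$ for all $f\in C_c(\mathbb{R})$. For $\lambda\in\mathbb{R}$, $e_\lambda(x):=e^{2\pi i\lambda x}$. A set $\{e_\lambda:\lambda\in\Lambda\}$ of mutually orthogonal exponentials in $L^2(\mu_4)$ is maximal if no $e_{\lambda'}$ with $\lambda'\in\mathbb{R}\setminus\Lambda$ is orthogonal to all $e_\lambda$, $\lambda\in\Lambda$. Base 4 expansion. For $k\in\mathbb{Z}$ put $k_0=k$ and inductively $k_n=d_n+4k_{n+1}$ with $d_n\in\{0,1,2,3\}$, $k_{n+1}\in\mathbb{Z}$. The infinite string $d_0d_1d_2\dots$ is the base 4 expansion of $k$, written $k=d_0d_1\dots$. It ends in $\underline 0=000\dots$ if $k\ge0$ and in $\underline 3=333\dots$ if $k<0$. Conversely every infinite string over $\{0,1,2,3\}$ ending in $\underline 0$ or $\underline 3$ is the expansion of exactly one integer: $d_0\dots d_N\underline 0=\sum_{n=0}^N4^nd_n$ and $d_0\dots d_N\underline 3=\sum_{n=0}^N4^nd_n-4^{N+1}$.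 Spectral labeling. Let $\mathcal T$ be the complete infinite rooted binary tree (root $\emptyset$, each vertex having two outgoing edges to its two children). A spectral labeling $\mathcal L$ is a labeling of the edges of $\mathcal T$ with labels in $\{0,1,2,3\}$ such that: (i) for each vertex $v$, the two edges starting from $v$ have labels of different parity; (ii) for each vertex $v$ there exists an infinite (downward) path starting from $v$ whose edges are eventually all labeled $0$ or eventually all labeled $3$. An infinite path is identified with the infinite word of labels read along it. Put $$\Lambda(\mathcal L):=\{k=d_0d_1\dots\in\mathbb{Z} : d_0d_1\dots\text{ is an infinite path in the tree starting from }\emptyset\text{ and ending in }\underline 0\text{ or }\underline 3\}.$$ *)

theory Defs
  imports "HOL-Probability.Probability"
begin

definition mu4_invariant :: "real measure \<Rightarrow> bool" where
  "mu4_invariant M \<longleftrightarrow>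
     (\<forall>f :: real \<Rightarrow> complex. continuous_on UNIV f \<and> compact (closure {x. f x \<noteq> 0}) \<longrightarrow>
        (\<integral>x. f x \<partial>M) = 1/2 * ((\<integral>x. f (x / 4) \<partial>M) + (\<integral>x. f ((x + 2) / 4) \<partial>M)))"

definition mu4 :: "real measure" where
  "mu4 = (THE M. prob_space M \<and> sets M = sets borel \<and> mu4_invariant M)"

definition expo :: "real \<Rightarrow> real \<Rightarrow> complex" where
  "expo l x = exp (2 * of_real pi * \<i> * of_real l * of_real x)"

definition L2_inner :: "real measure \<Rightarrow> (real \<Rightarrow> complex) \<Rightarrow> (real \<Rightarrow> complex) \<Rightarrow> complex" where
  "L2_inner M f g = (\<integral>x. f x * cnj (g x) \<partial>M)"

definition mutually_orthogonal_exponentials :: "real measure \<Rightarrow> real set \<Rightarrow> bool" where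
  "mutually_orthogonal_exponentials M S \<longleftrightarrow>
     (\<forall>l\<in>S. \<forall>l'\<in>S. l \<noteq> l' \<longrightarrow> L2_inner M (expo l) (expo l') = 0)"

definition maximal_orthogonal_exponentials :: "real measure \<Rightarrow> real set \<Rightarrow> bool" where
  "maximal_orthogonal_exponentials M S \<longleftrightarrow>
     mutually_orthogonal_exponentials M S \<and>
     \<not> (\<exists>l'. l' \<notin> S \<and> (\<forall>l\<in>S. L2_inner M (expo l') (expo l) = 0))"

definition base4_expansion :: "int \<Rightarrow> (nat \<Rightarrow> int) \<Rightarrow> bool" where
  "base4_expansion k d \<longleftrightarrow>
     (\<exists>r :: nat \<Rightarrow> int. r 0 = k \<and> (\<forall>n. d n \<in> {0, 1, 2, 3} \<and> r n = d n + 4 * r (Suc n)))"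

definition ends_in_0_or_3 :: "(nat \<Rightarrow> int) \<Rightarrow> bool" where
  "ends_in_0_or_3 d \<longleftrightarrow>
     (\<forall>\<^sub>F n in sequentially. d n = 0) \<or> (\<forall>\<^sub>F n in sequentially. d n = 3)"

text \<open>
  A vertex of the infinite binary tree is the list of choices leading to it from the root
  \<open>[]\<close>; the two edges starting from \<open>v\<close> go to \<open>v @ [False]\<close> and \<open>v @ [True]\<close>, and
  \<open>L v b\<close> is the label of the edge from \<open>v\<close> to \<open>v @ [b]\<close>. An infinite path from \<open>v\<close> is
  given by its sequence of choices \<open>p\<close>; \<open>path_word L v p\<close> is the word of labels along it.
\<close>

type_synonym labeling = "bool list \<Rightarrow> bool \<Rightarrow> int"

definition path_word :: "labeling \<Rightarrow> bool list \<Rightarrow> (nat \<Rightarrow> bool) \<Rightarrow> nat \<Rightarrow> int" where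
  "path_word L v p n = L (v @ map p [0..<n]) (p n)"

definition spectral_labeling :: "labeling \<Rightarrow> bool" where
  "spectral_labeling L \<longleftrightarrow>
     (\<forall>v b. L v b \<in> {0, 1, 2, 3}) \<and>
     (\<forall>v. even (L v False) \<longleftrightarrow> odd (L v True)) \<and>
     (\<forall>v. \<exists>p. ends_in_0_or_3 (path_word L v p))"

definition labeling_spectrum :: "labeling \<Rightarrow> int set" where
  "labeling_spectrum L =
     {k. \<exists>p. ends_in_0_or_3 (path_word L [] p) \<and> base4_expansion k (path_word L [] p)}"

end

theory Submission
  imports Defs
begin

text \<open>
  The Fourier transform of \<open>mu4\<close> satisfies
  \<open>char mu4 t = (1 + cis (t / 2)) / 2 * char mu4 (t / 4)\<close>, which determines the measure by
  continuity at \<open>0\<close> and shows that \<open>e\<^sub>k\<close> and \<open>e\<^sub>l\<close> are orthogonal iff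
  \<open>k - l = 4\<^sup>n * odd\<close>. For integers this says that the first base 4 digit in which \<open>k\<close> and \<open>l\<close>
  differ has different parities. Hence elements of an orthogonal set that agree in the parities of
  their first digits agree in the digits themselves, so such a set is a set of paths in the binary
  tree whose edges at a vertex are told apart by parity. Maximality means that every vertex is
  reached: if no element of the set extends a realised word by a digit of a given parity, adding
  \<open>4\<^sup>n\<close> to an element with that word gives an integer orthogonal to the whole set.
\<close>

section \<open>The invariant measure and the zeros of its Fourier transform\<close>

text \<open>\<open>mu4_invariant\<close> speaks only of compactly supported functions, which
  excludes exponentials. Cutting \<open>f\<close> off and passing to the limit by dominated
  convergence extends it to bounded continuous functions.\<close>

lemma mu4_invariant_bounded_continuous:
  fixes f :: "real \<Rightarrow> complex"
  assumes "real_distribution M" and inv: "mu4_invariant M"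
    and f: "continuous_on UNIV f" and B: "\<And>x. norm (f x) \<le> B"
  shows "(\<integral>x. f x \<partial>M) = 1/2 * ((\<integral>x. f (x / 4) \<partial>M) + (\<integral>x. f ((x + 2) / 4) \<partial>M))"
proof -
  interpret real_distribution M by fact
  \<comment> \<open>A continuous cutoff: 1 on [-n, n], 0 outside [-n-1, n+1], and within [0, 1]
    throughout, so that \<open>g n\<close> inherits the bound \<open>B\<close>.\<close>
  define c :: "nat \<Rightarrow> real \<Rightarrow> real" where "c n x = max 0 (min 1 (1 + real n - \<bar>x\<bar>))" for n x
  define g where "g n x = complex_of_real (c n x) * f x" for n x
  have c_range: "0 \<le> c n x" "c n x \<le> 1" for n x
    by (auto simp: c_def)
  have g_cont: "continuous_on UNIV (g n)" for n
    unfolding g_def c_def by (intro continuous_intros f)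
  have g_le: "norm (g n x) \<le> B" for n x
  proof -
    have "norm (g n x) \<le> 1 * norm (f x)"
      unfolding g_def norm_mult using c_range[of n x] by (intro mult_right_mono) auto
    with B[of x] show ?thesis by simp
  qed
  have g_supp: "compact (closure {x. g n x \<noteq> 0})" for n
  proof -
    have "{x. g n x \<noteq> 0} \<subseteq> cball 0 (1 + real n)"
      by (auto simp: g_def c_def split: if_splits)
    then show ?thesis by (simp add: bounded_subset[OF bounded_cball])
  qed
  have g_lim: "(\<lambda>n. g n x) \<longlonglongrightarrow> f x" for x
  proof (rule tendsto_eventually)
    have "g n x = f x" if "nat \<lceil>\<bar>x\<bar>\<rceil> \<le> n" for n
    proof -
      have "\<bar>x\<bar> \<le> real n" using that by linarith
      then show ?thesis by (simp add: g_def c_def)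
    qed
    then show "\<forall>\<^sub>F n in sequentially. g n x = f x"
      unfolding eventually_sequentially by blast
  qed
  have lim: "(\<lambda>n. \<integral>x. g n (h x) \<partial>M) \<longlonglongrightarrow> (\<integral>x. f (h x) \<partial>M)"
    if h: "continuous_on UNIV h" for h :: "real \<Rightarrow> real"
  proof (rule integral_dominated_convergence[where w = "\<lambda>_. B"])
    have "continuous_on UNIV (\<lambda>x. f (h x))" "continuous_on UNIV (\<lambda>x. g n (h x))" for n
      using continuous_on_compose2[OF f h] continuous_on_compose2[OF g_cont h] by auto
    then show "(\<lambda>x. f (h x)) \<in> borel_measurable M" "(\<lambda>x. g n (h x)) \<in> borel_measurable M" for n
      by (auto intro: measurable_finite_borel borel_measurable_continuous_onI)
  qed (use g_lim g_le in auto)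
  have "(\<integral>x. g n x \<partial>M) = 1/2 * ((\<integral>x. g n (x / 4) \<partial>M) + (\<integral>x. g n ((x + 2) / 4) \<partial>M))" for n
    using inv g_cont g_supp unfolding mu4_invariant_def by blast
  moreover have "(\<lambda>n. 1/2 * ((\<integral>x. g n (x / 4) \<partial>M) + (\<integral>x. g n ((x + 2) / 4) \<partial>M)))
      \<longlonglongrightarrow> 1/2 * ((\<integral>x. f (x / 4) \<partial>M) + (\<integral>x. f ((x + 2) / 4) \<partial>M))"
    by (intro tendsto_intros lim continuous_intros) auto
  ultimately have "(\<lambda>n. \<integral>x. g n x \<partial>M) \<longlonglongrightarrow>
      1/2 * ((\<integral>x. f (x / 4) \<partial>M) + (\<integral>x. f ((x + 2) / 4) \<partial>M))"
    by (simp only:)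
  moreover have "(\<lambda>n. \<integral>x. g n x \<partial>M) \<longlonglongrightarrow> (\<integral>x. f x \<partial>M)"
    by (intro lim continuous_intros)
  ultimately show ?thesis by (rule LIMSEQ_unique[rotated])
qed

text \<open>Invariance is applied to the function \<open>iexp (t * x)\<close>; the shift by 2/4 =
  1/2 in the second map produces the factor \<open>cis (t / 2)\<close>.\<close>

lemma char_mu4_invariant:
  assumes "real_distribution M" "mu4_invariant M"
  shows "char M t = (1 + cis (t / 2)) / 2 * char M (t / 4)"
proof -
  have eq: "iexp (t * (x / 4)) = iexp (t / 4 * x)"
    "iexp (t * ((x + 2) / 4)) = cis (t / 2) * iexp (t / 4 * x)" for x
  proof -
    have "\<i> * complex_of_real (t * ((x + 2) / 4))
        = \<i> * complex_of_real (t / 2) + \<i> * complex_of_real (t / 4 * x)"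
      by (simp add: complex_eq_iff field_simps)
    then show "iexp (t * ((x + 2) / 4)) = cis (t / 2) * iexp (t / 4 * x)"
      by (simp only: cis_conv_exp exp_add)
  qed simp
  have "char M t = 1/2 * ((\<integral>x. iexp (t * (x / 4)) \<partial>M) + (\<integral>x. iexp (t * ((x + 2) / 4)) \<partial>M))"
    unfolding char_def
    by (rule mu4_invariant_bounded_continuous[OF assms, where B = 1]) (auto intro!: continuous_intros)
  also have "\<dots> = 1/2 * (char M (t / 4) + cis (t / 2) * char M (t / 4))"
    unfolding char_def eq(2) unfolding eq(1) by (simp only: integral_mult_right_zero)
  finally show ?thesis
    by (simp add: distrib_right)
qed

lemma tendsto_char_scaled:
  assumes "real_distribution M"
  shows "(\<lambda>n. char M (t / 4 ^ n)) \<longlonglongrightarrow> 1"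
proof -
  interpret real_distribution M by fact
  have "(\<lambda>n. t * (1 / 4) ^ n) \<longlonglongrightarrow> t * 0"
    by (intro tendsto_intros LIMSEQ_power_zero) simp
  then have "(\<lambda>n. t / 4 ^ n) \<longlonglongrightarrow> 0"
    by (simp add: power_one_over)
  from isCont_tendsto_compose[OF isCont_char this] show ?thesis by (simp add: char_zero)
qed

text \<open>The difference of the two characteristic functions obeys the same functional equation,
  whose factor has norm at most 1. Its norm at \<open>t\<close> is therefore bounded by its norm at
  \<open>t / 4 ^ n\<close>, which tends to 0.\<close>

lemma mu4_invariant_unique:
  assumes M: "real_distribution M" "mu4_invariant M" and N: "real_distribution N" "mu4_invariant N"
  shows "M = N"
proof (rule Levy_uniqueness[OF M(1) N(1)])
  have contract: "norm (char M t - char N t) \<le> norm (char M (t / 4 ^ n) - char N (t / 4 ^ n))" for t n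
  proof (induction n)
    case (Suc n)
    let ?s = "t / 4 ^ n"
    have "char M ?s - char N ?s
        = (1 + cis (?s / 2)) / 2 * (char M (?s / 4) - char N (?s / 4))"
      using char_mu4_invariant[OF M, of ?s] char_mu4_invariant[OF N, of ?s]
      by (simp only: right_diff_distrib)
    moreover have "norm ((1 + cis (?s / 2)) / 2) \<le> 1"
      using norm_triangle_ineq[of 1 "cis (?s / 2)"] by (simp add: norm_divide)
    ultimately have "norm (char M ?s - char N ?s) \<le> 1 * norm (char M (?s / 4) - char N (?s / 4))"
      by (simp only: norm_mult) (intro mult_right_mono norm_ge_zero)
    with Suc show ?case by (simp add: mult.commute)
  qed simp
  show "char M = char N"
  proof
    fix t
    have "(\<lambda>n. norm (char M (t / 4 ^ n) - char N (t / 4 ^ n))) \<longlonglongrightarrow> norm (1 - 1 :: complex)"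
      using M(1) N(1) by (intro tendsto_intros tendsto_char_scaled)
    then have "norm (char M t - char N t) \<le> norm (1 - 1 :: complex)"
      by (rule LIMSEQ_le_const) (use contract in blast)
    then show "char M t = char N t" by simp
  qed
qed

text \<open>Iterating the functional equation writes the value as a finite product of factors
  \<open>(1 + cis (pi * x / 4 ^ n)) / 2\<close> times a value near 0. The latter is nonzero after
  enough steps, so a zero comes from some factor, that is, from an odd integer
  \<open>x / 4 ^ n\<close>.\<close>

lemma char_mu4_invariant_eq_0_iff:
  assumes "real_distribution M" "mu4_invariant M"
  shows "char M (2 * pi * x) = 0 \<longleftrightarrow> (\<exists>n m. x = 4 ^ n * (2 * of_int m + 1))"
proof -
  have step: "char M (2 * pi * x) = (1 + cis (pi * x)) / 2 * char M (2 * pi * (x / 4))" for x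
    using char_mu4_invariant[OF assms, of "2 * pi * x"] by simp
  have zero: "1 + cis (pi * x) = 0 \<longleftrightarrow> (\<exists>m. x = 2 * of_int m + 1)" for x
  proof -
    have "1 + cis (pi * x) = 0 \<longleftrightarrow> exp (\<i> * of_real (pi * x)) = exp (\<i> * of_real pi)"
      by (simp only: cis_conv_exp[symmetric] cis_pi add_eq_0_iff)
    also have "\<dots> \<longleftrightarrow> (\<exists>m. pi * x = pi * (2 * of_int m + 1))"
      unfolding exp_eq by (simp add: complex_eq_iff algebra_simps)
    finally show ?thesis by (simp only: mult_cancel_left pi_neq_zero simp_thms)
  qed
  show ?thesis
  proof
    assume char0: "char M (2 * pi * x) = 0"
    \<comment> \<open>This bounds the number of factors to inspect: induction on \<open>N\<close>
      strips one factor at a time, and for \<open>N = 0\<close> the two assumptions contradict each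
      other.\<close>
    have "\<forall>\<^sub>F n in sequentially. char M (2 * pi * x / 4 ^ n) \<noteq> 0"
      using tendsto_char_scaled[OF assms(1)] by (rule tendsto_imp_eventually_ne) simp
    then obtain N where "char M (2 * pi * x / 4 ^ N) \<noteq> 0"
      by (auto simp: eventually_sequentially)
    with char0 show "\<exists>n m. x = 4 ^ n * (2 * of_int m + 1)"
    proof (induction N arbitrary: x)
      case (Suc N)
      show ?case
      proof (cases "1 + cis (pi * x) = 0")
        case True
        then obtain m where "x = 2 * of_int m + 1" unfolding zero by blast
        then show ?thesis by (intro exI[of _ 0] exI[of _ m]) simp
      next
        case False
        then have "char M (2 * pi * (x / 4)) = 0" using Suc.prems(1) step[of x] by simp
        then obtain n m where "x / 4 = 4 ^ n * (2 * of_int m + 1)"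
          using Suc.IH[of "x / 4"] Suc.prems(2) by auto
        then have "x = 4 ^ Suc n * (2 * of_int m + 1)" by simp
        then show ?thesis by blast
      qed
    qed simp
  next
    assume "\<exists>n m. x = 4 ^ n * (2 * of_int m + 1)"
    then obtain n m where "x = 4 ^ n * (2 * of_int m + 1)" by blast
    then show "char M (2 * pi * x) = 0"
    proof (induction n arbitrary: x)
      case 0
      then have "1 + cis (pi * x) = 0" unfolding zero by auto
      then show ?case by (simp only: step[of x]) simp
    next
      case (Suc n)
      then have "char M (2 * pi * (x / 4)) = 0" by (intro Suc.IH) simp
      then show ?case by (simp only: step[of x]) simp
    qed
  qed
qed

section \<open>Existence of the measure by coin tossing\<close>

interpretation coins: sequence_space "measure_pmf (bernoulli_pmf (1 / 2))"
  by unfold_locales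

text \<open>The point of the Cantor set whose base 4 digits after the point are 0 or 2 according to
  the tosses; its law under fair tosses is the invariant measure.\<close>

definition cantor4 :: "(nat \<Rightarrow> bool) \<Rightarrow> real" where
  "cantor4 \<omega> = (\<Sum>n. of_bool (\<omega> n) * 2 / 4 ^ Suc n)"

text \<open>Prepending a toss shifts the digits by one place and so applies one of the two maps in
  the invariance equation.\<close>

lemma cantor4_case_nat: "cantor4 (case_nat b \<omega>) = (cantor4 \<omega> + 2 * of_bool b) / 4"
proof -
  have summable: "summable (\<lambda>n. of_bool (\<eta> n) * 2 / 4 ^ Suc n :: real)" for \<eta> :: "nat \<Rightarrow> bool"
  proof (rule summable_comparison_test'[where N = 0])
    show "summable (\<lambda>n. 2 * (1 / 4) ^ n :: real)"
      by (intro summable_mult summable_geometric) simp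
  qed (auto simp: power_one_over field_simps)
  have "cantor4 (case_nat b \<omega>) = (\<Sum>n. of_bool (\<omega> n) * 2 / 4 ^ Suc (Suc n)) + of_bool b * 2 / 4"
    unfolding cantor4_def using suminf_split_head[OF summable[of "case_nat b \<omega>"]] by simp
  also have "(\<Sum>n. of_bool (\<omega> n) * 2 / 4 ^ Suc (Suc n)) = (\<Sum>n. of_bool (\<omega> n) * 2 / 4 ^ Suc n / 4 :: real)"
    by (simp add: field_simps)
  also have "\<dots> = cantor4 \<omega> / 4"
    unfolding cantor4_def by (rule suminf_divide[OF summable])
  finally show ?thesis by (simp add: add_divide_distrib)
qed

lemma measurable_cantor4 [measurable]: "cantor4 \<in> borel_measurable coins.S"
proof -
  have "(\<lambda>\<omega>. of_bool (\<omega> n) :: real) \<in> borel_measurable coins.S" for n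
    by (rule measurable_compose[OF measurable_component_singleton[of n]]) auto
  then show ?thesis unfolding cantor4_def[abs_def] by measurable
qed

text \<open>Prepending an independent fair toss preserves the law of the sequence of tosses
  (\<open>coins.PiM_iter\<close>). Integrating over that toss first separates the two maps, each
  with weight 1/2.\<close>

lemma mu4_invariant_distr_cantor4: "mu4_invariant (distr coins.S borel cantor4)"
  unfolding mu4_invariant_def
proof (intro allI impI, elim conjE)
  fix f :: "real \<Rightarrow> complex"
  assume f: "continuous_on UNIV f" and supp: "compact (closure {x. f x \<noteq> 0})"
  have [measurable]: "f \<in> borel_measurable borel"
    by (rule borel_measurable_continuous_onI[OF f])
  \<comment> \<open>Boundedness makes the integrand integrable on the product space, as Fubini
    requires.\<close>
  obtain B where B: "norm (f x) \<le> B" for x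
  proof -
    have "bounded (f ` closure {x. f x \<noteq> 0})"
      using f supp by (intro compact_imp_bounded compact_continuous_image) (auto intro: continuous_on_subset)
    then obtain B where "0 < B" and B: "\<And>x. x \<in> closure {x. f x \<noteq> 0} \<Longrightarrow> norm (f x) \<le> B"
      by (auto simp: bounded_pos)
    have "norm (f x) \<le> B" for x
      using B[of x] closure_subset[of "{x. f x \<noteq> 0}"] \<open>0 < B\<close> by (cases "f x = 0") auto
    with that show thesis by blast
  qed
  let ?C = "measure_pmf (bernoulli_pmf (1 / 2))"
  interpret P: pair_prob_space ?C coins.S ..
  have meas[measurable]: "(\<lambda>(s, \<omega>). case_nat s \<omega>) \<in> measurable (?C \<Otimes>\<^sub>M coins.S) coins.S"
    by measurable
  have int: "integrable (?C \<Otimes>\<^sub>M coins.S) (\<lambda>(s, \<omega>). f (cantor4 (case_nat s \<omega>)))"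
    by (rule P.integrable_const_bound[of _ B]) (auto simp: B split_beta')
  have "(\<integral>x. f x \<partial>distr coins.S borel cantor4) = (\<integral>\<omega>. f (cantor4 \<omega>) \<partial>coins.S)"
    by (rule integral_distr) measurable
  also have "\<dots> = (\<integral>\<omega>. f (cantor4 \<omega>) \<partial>distr (?C \<Otimes>\<^sub>M coins.S) coins.S (\<lambda>(s, \<omega>). case_nat s \<omega>))"
    by (simp only: coins.PiM_iter)
  also have "\<dots> = (\<integral>(s, \<omega>). f (cantor4 (case_nat s \<omega>)) \<partial>(?C \<Otimes>\<^sub>M coins.S))"
    by (subst integral_distr[OF meas]) (auto simp: split_beta')
  also have "\<dots> = (\<integral>s. \<integral>\<omega>. f (cantor4 (case_nat s \<omega>)) \<partial>coins.S \<partial>?C)"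
    using P.integral_fst'[OF int] by simp
  also have "\<dots> = 1/2 * ((\<integral>\<omega>. f (cantor4 \<omega> / 4) \<partial>coins.S) + (\<integral>\<omega>. f ((cantor4 \<omega> + 2) / 4) \<partial>coins.S))"
    by (subst integral_measure_pmf[of UNIV])
       (auto simp: UNIV_bool cantor4_case_nat scaleR_conv_of_real field_simps)
  also have "\<dots> = 1/2 * ((\<integral>x. f (x / 4) \<partial>distr coins.S borel cantor4)
      + (\<integral>x. f ((x + 2) / 4) \<partial>distr coins.S borel cantor4))"
    by (subst (1 2) integral_distr) measurable
  finally show "(\<integral>x. f x \<partial>distr coins.S borel cantor4)
      = 1/2 * ((\<integral>x. f (x / 4) \<partial>distr coins.S borel cantor4)
      + (\<integral>x. f ((x + 2) / 4) \<partial>distr coins.S borel cantor4))" .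
qed

lemma mu4: "real_distribution mu4" "mu4_invariant mu4"
proof -
  let ?D = "distr coins.S borel cantor4"
  have rd: "real_distribution M \<longleftrightarrow> prob_space M \<and> sets M = sets borel" for M
    by (auto simp: real_distribution_def real_distribution_axioms_def)
  have D: "real_distribution ?D" by (rule coins.P.real_distribution_distr) measurable
  have "\<exists>!M. prob_space M \<and> sets M = sets borel \<and> mu4_invariant M"
    using D mu4_invariant_distr_cantor4 mu4_invariant_unique unfolding rd by blast
  from theI'[OF this] show "real_distribution mu4" "mu4_invariant mu4"
    unfolding mu4_def[symmetric] rd by blast+
qed

text \<open>The conjugate turns the product of exponentials into one exponential of frequency
  \<open>l - l'\<close>, so the inner product is a value of the characteristic function.\<close>

lemma L2_inner_expo_eq_0_iff:
  "L2_inner mu4 (expo l) (expo l') = 0 \<longleftrightarrow> (\<exists>n m. l - l' = 4 ^ n * (2 * of_int m + 1))"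
proof -
  have "L2_inner mu4 (expo l) (expo l') = char mu4 (2 * pi * (l - l'))"
    unfolding L2_inner_def char_def expo_def
    by (intro Bochner_Integration.integral_cong refl)
       (simp add: exp_cnj exp_add[symmetric] algebra_simps)
  then show ?thesis by (simp add: char_mu4_invariant_eq_0_iff[OF mu4])
qed

section \<open>Base 4 digits\<close>

text \<open>Since \<open>div\<close> rounds downwards, this closed form gives the expansion of
  negative integers as well.\<close>

definition digit :: "int \<Rightarrow> nat \<Rightarrow> int" where
  "digit k n = (k div 4 ^ n) mod 4"

lemma digit_range: "digit k n \<in> {0, 1, 2, 3}"
proof -
  have "0 \<le> digit k n" "digit k n < 4"
    by (simp_all add: digit_def)
  then show ?thesis by auto
qed

lemma digit_0: "digit k 0 = k mod 4"
  by (simp add: digit_def)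

lemma odd_digit: "odd (digit k n) \<longleftrightarrow> odd (k div 4 ^ n)"
  unfolding digit_def by (simp add: dvd_mod_iff)

lemma digit_Suc: "digit k (Suc n) = digit (k div 4) n"
  by (simp add: digit_def zdiv_zmult2_eq)

text \<open>With digits in 0, ..., 3 the recursion is division by 4 with remainder, which forces
  \<open>r n = k div 4 ^ n\<close>.\<close>

lemma base4_expansion_iff: "base4_expansion k d \<longleftrightarrow> d = digit k"
proof
  assume "base4_expansion k d"
  then obtain r where r0: "r 0 = k"
    and r: "\<And>n. d n \<in> {0, 1, 2, 3}" "\<And>n. r n = d n + 4 * r (Suc n)"
    unfolding base4_expansion_def by blast
  have divmod: "d n = r n mod 4" "r (Suc n) = r n div 4" for n
    using r(1)[of n] r(2)[of n] by auto
  have "r n = k div 4 ^ n" for n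
    by (induction n) (simp_all add: r0 divmod(2) zdiv_zmult2_eq[symmetric] mult.commute)
  then show "d = digit k"
    by (auto simp: digit_def divmod(1))
next
  assume d: "d = digit k"
  have "k div 4 ^ n = digit k n + 4 * (k div 4 ^ Suc n)" for n
  proof -
    have "k div 4 ^ Suc n = (k div 4 ^ n) div 4"
      by (simp only: power_Suc2 zdiv_zmult2_eq[of 4 k "4 ^ n"]) 
    then show ?thesis by (simp add: digit_def)
  qed
  then show "base4_expansion k d"
    unfolding base4_expansion_def d using digit_range
    by (intro exI[of _ "\<lambda>n. k div 4 ^ n"]) simp
qed

lemma abs_less_power4:
  fixes k :: int
  assumes "nat \<bar>k\<bar> \<le> n"
  shows "\<bar>k\<bar> < 4 ^ n"
proof -
  have "n < 4 ^ n" by (induction n) auto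
  then have "int n < 4 ^ n" by (metis of_nat_less_iff of_nat_numeral of_nat_power)
  with assms show ?thesis by linarith
qed

text \<open>Once \<open>4 ^ n\<close> exceeds the absolute value of \<open>k\<close>, the quotient
  is 0 or -1, with residue 0 or 3 modulo 4.\<close>

lemma ends_in_0_or_3_digit: "ends_in_0_or_3 (digit k)"
proof -
  show ?thesis
  proof (cases "0 \<le> k")
    case True
    have "digit k n = 0" if "nat \<bar>k\<bar> \<le> n" for n
      using abs_less_power4[OF that] True by (simp add: digit_def)
    then show ?thesis
      unfolding ends_in_0_or_3_def eventually_sequentially by blast
  next
    case False
    have "digit k n = 3" if "nat \<bar>k\<bar> \<le> n" for n
    proof -
      have "k div 4 ^ n = - 1"
        using abs_less_power4[OF that] False by (intro int_div_pos_eq[where r = "k + 4 ^ n"]) auto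
      then show ?thesis by (simp add: digit_def)
    qed
    then show ?thesis
      unfolding ends_in_0_or_3_def eventually_sequentially by blast
  qed
qed

text \<open>The constant strings 0 and 3 belong to 0 and -1, and prepending a digit \<open>c\<close>
  to the expansion of \<open>k\<close> gives that of \<open>c + 4 * k\<close>. Induction on the
  length of the part before the constant tail does the rest.\<close>

lemma exists_digits:
  assumes "\<And>n. d n \<in> {0, 1, 2, 3}" "ends_in_0_or_3 d"
  obtains k where "digit k = d"
proof -
  have const: "\<exists>k. digit k = (\<lambda>_. c)" if "c \<in> {0, 3}" for c
  proof (cases "c = 0")
    case True
    then show ?thesis by (intro exI[of _ 0]) (auto simp: digit_def)
  next
    case False
    have "digit (- 1) n = 3" for n
      by (induction n) (simp_all add: digit_0 digit_Suc)
    with False that show ?thesis by (intro exI[of _ "- 1"]) auto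
  qed
  have tail: "\<exists>k. digit k = e"
    if "c \<in> {0, 3}" "\<And>n. e n \<in> {0, 1, 2, 3}" "\<And>n. N \<le> n \<Longrightarrow> e n = c" for c N e
    using that(2,3)
  proof (induction N arbitrary: e)
    case 0
    then have "e = (\<lambda>_. c)" by auto
    with const[OF \<open>c \<in> {0, 3}\<close>] show ?case by simp
  next
    case (Suc N)
    have "\<exists>k. digit k = (\<lambda>n. e (Suc n))"
      using Suc.prems by (intro Suc.IH) auto
    then obtain k where k: "digit k = (\<lambda>n. e (Suc n))" ..
    have "digit (e 0 + 4 * k) n = e n" for n
    proof (cases n)
      case 0
      then show ?thesis using Suc.prems(1)[of 0] by (auto simp: digit_0)
    next
      case (Suc m)
      have "(e 0 + 4 * k) div 4 = k"
        using Suc.prems(1)[of 0] by auto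
      then show ?thesis using k Suc by (simp add: digit_Suc)
    qed
    then show ?case by blast
  qed
  obtain c N where "c \<in> {0, 3}" "\<And>n. N \<le> n \<Longrightarrow> d n = c"
    using assms(2) unfolding ends_in_0_or_3_def eventually_sequentially by blast
  with tail[of c d N] assms(1) that show thesis by blast
qed

lemma mod_pow4_eq_iff_digits:
  "k mod 4 ^ n = l mod 4 ^ n \<longleftrightarrow> (\<forall>i<n. digit k i = digit l i)"
proof (induction n)
  case (Suc n)
  have split: "j mod 4 ^ Suc n = 4 ^ n * digit j n + j mod 4 ^ n" for j :: int
    by (simp only: power_Suc2 zmod_zmult2_eq[of 4 j "4 ^ n"] digit_def)
  have lower: "j mod 4 ^ Suc n mod 4 ^ n = j mod 4 ^ n" for j :: int
    by (simp add: mod_mod_cancel)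
  have "k mod 4 ^ Suc n = l mod 4 ^ Suc n \<longleftrightarrow> k mod 4 ^ n = l mod 4 ^ n \<and> digit k n = digit l n"
  proof
    assume eq: "k mod 4 ^ Suc n = l mod 4 ^ Suc n"
    then have "k mod 4 ^ n = l mod 4 ^ n" using lower by metis
    with eq split[of k] split[of l] show "k mod 4 ^ n = l mod 4 ^ n \<and> digit k n = digit l n"
      by simp
  qed (simp only: split)
  with Suc show ?case by (simp only: All_less_Suc) blast
qed simp

text \<open>Equal digits make \<open>k - l\<close> divisible by every power of 4, including one that
  exceeds its absolute value.\<close>

lemma digits_inject: "digit k = digit l \<Longrightarrow> k = l"
proof -
  assume eq: "digit k = digit l"
  define n where "n = nat \<bar>k - l\<bar>"
  have "4 ^ n dvd k - l"
    using eq mod_pow4_eq_iff_digits[of k n l] by (simp add: mod_eq_dvd_iff)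
  moreover have "\<bar>k - l\<bar> < 4 ^ n" by (rule abs_less_power4) (simp add: n_def)
  ultimately show "k = l"
    using dvd_imp_le_int[of "k - l" "4 ^ n"] by auto
qed

lemma first_difference:
  fixes f g :: "nat \<Rightarrow> 'a"
  assumes "f \<noteq> g"
  obtains n where "\<And>i. i < n \<Longrightarrow> f i = g i" "f n \<noteq> g n"
proof -
  have "\<exists>n. f n \<noteq> g n" using assms by auto
  then show thesis using that by (auto simp: exists_least_iff[of "\<lambda>n. f n \<noteq> g n"])
qed

section \<open>Orthogonality of integer frequencies in terms of digits\<close>

definition orth :: "int \<Rightarrow> int \<Rightarrow> bool" where
  "orth k l \<longleftrightarrow> (\<exists>n m. k - l = 4 ^ n * (2 * m + 1))"

text \<open>For each \<open>n\<close>, the difference is \<open>4 ^ n\<close> times an odd number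
  iff the residues modulo \<open>4 ^ n\<close> agree and the quotients differ in parity; the parity
  of the quotient is that of the digit \<open>n\<close>.\<close>

lemma orth_iff_digits:
  "orth k l \<longleftrightarrow>
    (\<exists>n. (\<forall>i<n. digit k i = digit l i) \<and> odd (digit k n) \<noteq> odd (digit l n))"
proof -
  have "(\<exists>m. k - l = 4 ^ n * (2 * m + 1)) \<longleftrightarrow>
      k mod 4 ^ n = l mod 4 ^ n \<and> odd (k div 4 ^ n) \<noteq> odd (l div 4 ^ n)" for n
  proof
    assume "\<exists>m. k - l = 4 ^ n * (2 * m + 1)"
    then obtain m where m: "k = l + 4 ^ n * (2 * m + 1)" by (auto simp: algebra_simps)
    then have "k div 4 ^ n = l div 4 ^ n + (2 * m + 1)" by simp
    with m show "k mod 4 ^ n = l mod 4 ^ n \<and> odd (k div 4 ^ n) \<noteq> odd (l div 4 ^ n)" by simp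
  next
    assume *: "k mod 4 ^ n = l mod 4 ^ n \<and> odd (k div 4 ^ n) \<noteq> odd (l div 4 ^ n)"
    then obtain c where c: "k - l = 4 ^ n * c" by (auto simp: mod_eq_dvd_iff)
    then have "k = l + 4 ^ n * c" by simp
    with * have "odd c" by auto
    with c show "\<exists>m. k - l = 4 ^ n * (2 * m + 1)" by (auto elim: oddE)
  qed
  then show ?thesis
    by (auto simp: orth_def mod_pow4_eq_iff_digits odd_digit)
qed

text \<open>The first position where orthogonal integers differ already separates parities, so it
  cannot lie below \<open>n\<close>. Parities thus determine digits within an orthogonal
  set.\<close>

lemma orth_first_differing:
  assumes "orth k l" "\<And>i. i < n \<Longrightarrow> odd (digit k i) = odd (digit l i)"
  shows "i < n \<Longrightarrow> digit k i = digit l i"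
    and "digit k n \<noteq> digit l n \<Longrightarrow> odd (digit k n) \<noteq> odd (digit l n)"
proof -
  obtain m where m: "\<And>i. i < m \<Longrightarrow> digit k i = digit l i" "odd (digit k m) \<noteq> odd (digit l m)"
    using assms(1) by (auto simp: orth_iff_digits)
  then have "n \<le> m" using assms(2) by (meson not_le)
  then show "i < n \<Longrightarrow> digit k i = digit l i"
    and "digit k n \<noteq> digit l n \<Longrightarrow> odd (digit k n) \<noteq> odd (digit l n)"
    using m by (auto simp: le_less)
qed

section \<open>Spectral labelings and maximal sets\<close>

text \<open>Maximality is put as a criterion for membership, the form in which it is applied
  below.\<close>

definition maximal_orth :: "int set \<Rightarrow> bool" where
  "maximal_orth A \<longleftrightarrow> (\<forall>k\<in>A. \<forall>l\<in>A. k \<noteq> l \<longrightarrow> orth k l) \<and> (\<forall>k. (\<forall>l\<in>A. orth k l) \<longrightarrow> k \<in> A)"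

lemma maximal_orth_orthD: "maximal_orth A \<Longrightarrow> k \<in> A \<Longrightarrow> l \<in> A \<Longrightarrow> k \<noteq> l \<Longrightarrow> orth k l"
  by (simp add: maximal_orth_def)

lemma maximal_orth_memI: "maximal_orth A \<Longrightarrow> (\<And>l. l \<in> A \<Longrightarrow> orth k l) \<Longrightarrow> k \<in> A"
  by (simp add: maximal_orth_def)

lemma path_word_cong:
  "(\<And>i. i \<le> n \<Longrightarrow> p i = q i) \<Longrightarrow> path_word L v p n = path_word L v q n"
proof -
  assume *: "\<And>i. i \<le> n \<Longrightarrow> p i = q i"
  then have "map p [0..<n] = map q [0..<n]" by auto
  moreover have "p n = q n" using * by simp
  ultimately show ?thesis by (simp only: path_word_def)
qed

lemma labeling_spectrum_iff: "k \<in> labeling_spectrum L \<longleftrightarrow> (\<exists>p. digit k = path_word L [] p)"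
  using ends_in_0_or_3_digit[of k]
  unfolding labeling_spectrum_def base4_expansion_iff mem_Collect_eq
  by (intro iff_exI) auto

lemma ends_in_0_or_3_shift: "ends_in_0_or_3 (\<lambda>n. d (n + k)) \<longleftrightarrow> ends_in_0_or_3 d"
  using eventually_sequentially_seg[of "\<lambda>n. d n = 0" k]
    eventually_sequentially_seg[of "\<lambda>n. d n = 3" k]
  by (simp add: ends_in_0_or_3_def)

lemma odd_spectral_labeling_Not:
  assumes "spectral_labeling L"
  shows "odd (L v b) \<noteq> odd (L v (\<not> b))"
  using assms unfolding spectral_labeling_def by (cases b) auto

text \<open>Two elements are orthogonal because their paths part at a vertex, where the two edges
  carry labels of different parity.\<close>

lemma maximal_orth_labeling_spectrum:
  assumes L: "spectral_labeling L"
  shows "maximal_orth (labeling_spectrum L)"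
  unfolding maximal_orth_def
proof (intro conjI ballI allI impI)
  fix k l assume "k \<in> labeling_spectrum L" "l \<in> labeling_spectrum L" "k \<noteq> l"
  then obtain p q where p: "digit k = path_word L [] p" and q: "digit l = path_word L [] q"
    by (auto simp: labeling_spectrum_iff)
  have "p \<noteq> q" using p q \<open>k \<noteq> l\<close> digits_inject by metis
  then obtain n where n: "\<And>i. i < n \<Longrightarrow> p i = q i" "p n \<noteq> q n"
    by (rule first_difference) blast
  have "digit k i = digit l i" if "i < n" for i
    unfolding p q using that n(1) by (intro path_word_cong) auto
  moreover have "odd (digit k n) \<noteq> odd (digit l n)"
  proof -
    have "map p [0..<n] = map q [0..<n]" using n(1) by auto
    moreover have "q n = (\<not> p n)" using n(2) by auto
    ultimately show ?thesis
      unfolding p q path_word_def by (simp only: append_Nil odd_spectral_labeling_Not[OF L] not_False_eq_True)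
  qed
  ultimately show "orth k l" unfolding orth_iff_digits by blast
next
  fix k assume orth: "\<forall>l\<in>labeling_spectrum L. orth k l"
  \<comment> \<open>\<open>p\<close> follows the parities of the digits of \<open>k\<close>. Wherever its word deviated from \<open>k\<close>, leaving it
    along a path that ends well would give an element of the spectrum not orthogonal to \<open>k\<close>.\<close>
  define step where "step v = v @ [odd (digit k (length v)) = odd (L v True)]" for v
  \<comment> \<open>The choice at depth \<open>n\<close> depends on all earlier ones. Iterating
    \<open>step\<close> on vertices avoids a recursion over prefixes of \<open>p\<close>; the direct
    form is recovered from \<open>vertex\<close>.\<close>
  define p where "p n = (odd (digit k n) = odd (L ((step ^^ n) []) True))" for n
  have step: "step v = v @ [odd (digit k (length v)) = odd (L v True)]" for v
    by (simp add: step_def)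
  have p_step: "p n \<longleftrightarrow> odd (digit k n) = odd (L ((step ^^ n) []) True)" for n
    by (simp add: p_def)
  have length_step: "length ((step ^^ n) []) = n" for n
    by (induction n) (simp_all add: step)
  have vertex: "(step ^^ n) [] = map p [0..<n]" for n
  proof (induction n)
    case (Suc n)
    have "(step ^^ Suc n) [] = (step ^^ n) [] @ [p n]"
      by (simp add: step length_step p_step)
    with Suc show ?case by simp
  qed simp
  have p: "p n \<longleftrightarrow> odd (digit k n) = odd (L (map p [0..<n]) True)" for n
    using p_step[of n] by (simp only: vertex)
  have parity: "odd (path_word L [] p n) = odd (digit k n)" for n
    using p[of n] odd_spectral_labeling_Not[OF L, of "map p [0..<n]" True]
    by (cases "p n") (simp_all add: path_word_def)
  have "digit k n = path_word L [] p n" for n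
  proof -
    obtain q where q: "ends_in_0_or_3 (path_word L (map p [0..<Suc n]) q)"
      using L unfolding spectral_labeling_def by blast
    \<comment> \<open>The path follows \<open>p\<close> through edge \<open>n\<close> inclusive,
      hence the offset \<open>Suc n\<close>, and then continues along \<open>q\<close> to a good
      tail.\<close>
    define r where "r i = (if i \<le> n then p i else q (i - Suc n))" for i
    have shift: "path_word L [] r (i + Suc n) = path_word L (map p [0..<Suc n]) q i" for i
    proof -
      have "map r [0..<i + Suc n] = map p [0..<Suc n] @ map q [0..<i]"
      proof (rule nth_equalityI)
        fix j assume "j < length (map r [0..<i + Suc n])"
        then show "map r [0..<i + Suc n] ! j = (map p [0..<Suc n] @ map q [0..<i]) ! j"
          by (auto simp: r_def nth_append simp del: upt_Suc)
      qed simp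
      then show ?thesis by (simp add: path_word_def r_def)
    qed
    have "ends_in_0_or_3 (path_word L [] r)"
      using q ends_in_0_or_3_shift[of "path_word L [] r" "Suc n"] by (simp only: shift)
    moreover have "path_word L [] r i \<in> {0, 1, 2, 3}" for i
      using L unfolding spectral_labeling_def path_word_def by blast
    ultimately obtain l where l: "digit l = path_word L [] r"
      using exists_digits by blast
    then have "l \<in> labeling_spectrum L" by (auto simp: labeling_spectrum_iff)
    with orth have "orth k l" by blast
    have agree: "digit l i = path_word L [] p i" if "i \<le> n" for i
      unfolding l using that by (intro path_word_cong) (auto simp: r_def)
    then have same_parity: "odd (digit k i) = odd (digit l i)" if "i \<le> n" for i
      using that parity by simp
    \<comment> \<open>All parities up to \<open>n\<close> agree, so orthogonality of
      \<open>k\<close> and \<open>l\<close> leaves no room for a difference at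
      \<open>n\<close>.\<close>
    have "digit k n = digit l n"
    proof (rule ccontr)
      assume "digit k n \<noteq> digit l n"
      from orth_first_differing(2)[OF \<open>orth k l\<close> _ this] have "odd (digit k n) \<noteq> odd (digit l n)"
        by (simp add: same_parity)
      with same_parity show False by blast
    qed
    with agree show ?thesis by simp
  qed
  then have "digit k = path_word L [] p" by auto
  then show "k \<in> labeling_spectrum L" by (auto simp: labeling_spectrum_iff)
qed

section \<open>The labeling of a maximal set\<close>

definition parity_cylinder :: "int set \<Rightarrow> bool list \<Rightarrow> int set" where
  "parity_cylinder A v = {k \<in> A. \<forall>i<length v. odd (digit k i) = v ! i}"

text \<open>Vertices serve as parity patterns, \<open>True\<close> meaning odd. The choice of
  \<open>k\<close> is immaterial for nonempty maximal \<open>A\<close>: the cylinder is then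
  nonempty and its members share this digit.\<close>

definition cylinder_labeling :: "int set \<Rightarrow> labeling" where
  "cylinder_labeling A v b = digit (SOME k. k \<in> parity_cylinder A (v @ [b])) (length v)"

lemma parity_cylinder_snoc:
  "k \<in> parity_cylinder A (v @ [b]) \<longleftrightarrow> k \<in> parity_cylinder A v \<and> odd (digit k (length v)) = b"
proof -
  have "(\<forall>i<length (v @ [b]). odd (digit k i) = (v @ [b]) ! i)
      \<longleftrightarrow> odd (digit k (length v)) = b \<and> (\<forall>i<length v. odd (digit k i) = v ! i)"
    by (simp only: length_append_singleton All_less_Suc nth_append_length) (simp add: nth_append)
  then show ?thesis
    unfolding parity_cylinder_def mem_Collect_eq by blast
qed

lemma parity_cylinder_digit_eq:
  assumes "maximal_orth A" "k \<in> parity_cylinder A v" "l \<in> parity_cylinder A v" "i < length v"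
  shows "digit k i = digit l i"
proof (cases "k = l")
  case False
  then have "orth k l"
    using assms by (intro maximal_orth_orthD) (auto simp: parity_cylinder_def)
  then show ?thesis
    using assms by (intro orth_first_differing(1)) (auto simp: parity_cylinder_def)
qed simp

text \<open>If parity \<open>b\<close> were missing after \<open>v\<close>, the modified integer
  \<open>k'\<close> would be orthogonal to all of \<open>A\<close>, hence in \<open>A\<close> by
  maximality, and would itself realise the missing parity.\<close>

lemma parity_cylinder_nonempty:
  assumes A: "maximal_orth A" "A \<noteq> {}"
  shows "parity_cylinder A v \<noteq> {}"
proof (induction v rule: rev_induct)
  case Nil
  then show ?case using A by (auto simp: parity_cylinder_def)
next
  case (snoc b v)
  then obtain k where k: "k \<in> parity_cylinder A v" by blast
  let ?n = "length v"
  show ?case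
  proof (rule ccontr)
    assume "\<not> parity_cylinder A (v @ [b]) \<noteq> {}"
    then have none: "odd (digit l ?n) \<noteq> b" if "l \<in> parity_cylinder A v" for l
      using that parity_cylinder_snoc by blast
    \<comment> \<open>Adding \<open>4 ^ ?n\<close> keeps the digits below \<open>?n\<close> and
      flips the parity of the digit at \<open>?n\<close>.\<close>
    define k' where "k' = k + 4 ^ ?n"
    have "k' mod 4 ^ ?n = k mod 4 ^ ?n" by (simp add: k'_def)
    then have low: "digit k' i = digit k i" if "i < ?n" for i
      using that mod_pow4_eq_iff_digits by blast
    have flip: "odd (digit k' ?n) = b"
      using none[OF k] by (auto simp: odd_digit k'_def)
    have "orth k' l" if "l \<in> A" for l
    proof (cases "l \<in> parity_cylinder A v")
      case True
      then have "odd (digit k' ?n) \<noteq> odd (digit l ?n)" using none flip by blast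
      moreover have "digit k' i = digit l i" if "i < ?n" for i
        using that low parity_cylinder_digit_eq[OF A(1) k True] by simp
      ultimately show ?thesis unfolding orth_iff_digits by blast
    next
      case False
      then have "orth k l"
        using A(1) k that by (intro maximal_orth_orthD) (auto simp: parity_cylinder_def)
      then obtain j where j: "\<And>i. i < j \<Longrightarrow> digit k i = digit l i" "odd (digit k j) \<noteq> odd (digit l j)"
        unfolding orth_iff_digits by blast
      \<comment> \<open>The first difference between \<open>k\<close> and \<open>l\<close> lies in
        the part where \<open>k'\<close> has the same digits as \<open>k\<close>.\<close>
      have "j < ?n"
      proof (rule ccontr)
        assume "\<not> j < ?n"
        then have "l \<in> parity_cylinder A v"
          using k j(1) that by (auto simp: parity_cylinder_def)
        with False show False by blast
      qed
      with j low show ?thesis unfolding orth_iff_digits by (intro exI[of _ j]) auto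
    qed
    then have "k' \<in> A" using A(1) by (rule maximal_orth_memI[rotated])
    moreover have "odd (digit k' i) = v ! i" if "i < ?n" for i
      using that k low by (auto simp: parity_cylinder_def)
    ultimately have "k' \<in> parity_cylinder A v" by (auto simp: parity_cylinder_def)
    with none flip show False by blast
  qed
qed

lemma cylinder_labeling_eq_digit:
  assumes "maximal_orth A" "k \<in> parity_cylinder A (v @ [b])"
  shows "cylinder_labeling A v b = digit k (length v)"
proof -
  have "(SOME k. k \<in> parity_cylinder A (v @ [b])) \<in> parity_cylinder A (v @ [b])"
    using assms(2) by (rule someI[of "\<lambda>k. k \<in> parity_cylinder A (v @ [b])"])
  from parity_cylinder_digit_eq[OF assms(1) this assms(2)] show ?thesis
    by (simp add: cylinder_labeling_def)
qed

lemma odd_cylinder_labeling: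
  assumes "maximal_orth A" "A \<noteq> {}"
  shows "odd (cylinder_labeling A v b) = b"
proof -
  obtain k where k: "k \<in> parity_cylinder A (v @ [b])"
    using parity_cylinder_nonempty[OF assms] by blast
  then show ?thesis
    unfolding cylinder_labeling_eq_digit[OF assms(1) k] by (simp add: parity_cylinder_snoc)
qed

text \<open>By induction \<open>k\<close> lies in the cylinder of each vertex on the path, so every
  label can be read off \<open>k\<close> itself.\<close>

lemma path_word_cylinder_labeling:
  assumes "maximal_orth A" "k \<in> parity_cylinder A v"
  shows "path_word (cylinder_labeling A) v (\<lambda>i. odd (digit k (i + length v))) n
    = digit k (n + length v)"
proof -
  let ?p = "\<lambda>i. odd (digit k (i + length v))"
  have "k \<in> parity_cylinder A (v @ map ?p [0..<i])" for i
  proof (induction i)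
    case (Suc i)
    then show ?case
      using parity_cylinder_snoc[of k A "v @ map ?p [0..<i]" "?p i"] by (simp add: add.commute)
  qed (use assms in simp)
  from this[of "Suc n"] show ?thesis
    using cylinder_labeling_eq_digit[OF assms(1), of k "v @ map ?p [0..<n]" "?p n"]
    by (simp add: path_word_def add.commute)
qed

lemma spectral_cylinder_labeling:
  assumes A: "maximal_orth A" "A \<noteq> {}"
  shows "spectral_labeling (cylinder_labeling A)"
  unfolding spectral_labeling_def
proof (intro conjI allI)
  show "cylinder_labeling A v b \<in> {0, 1, 2, 3}" for v b
    unfolding cylinder_labeling_def by (rule digit_range)
  show "even (cylinder_labeling A v False) = odd (cylinder_labeling A v True)" for v
    using odd_cylinder_labeling[OF A] by blast
  fix v
  obtain k where "k \<in> parity_cylinder A v" using parity_cylinder_nonempty[OF A] by blast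
  note word = path_word_cylinder_labeling[OF A(1) this]
  have "ends_in_0_or_3 (\<lambda>n. digit k (n + length v))"
    using ends_in_0_or_3_digit[of k] by (simp only: ends_in_0_or_3_shift)
  then show "\<exists>p. ends_in_0_or_3 (path_word (cylinder_labeling A) v p)"
    by (intro exI[of _ "\<lambda>i. odd (digit k (i + length v))"])
       (simp add: word[abs_def])
qed

text \<open>An element of \<open>A\<close> follows its own parities. Conversely, a path integer
  \<open>k\<close> outside \<open>A\<close> would be orthogonal to all of \<open>A\<close>, which
  maximality forbids.\<close>

lemma labeling_spectrum_cylinder_labeling:
  assumes A: "maximal_orth A" "A \<noteq> {}"
  shows "labeling_spectrum (cylinder_labeling A) = A"
proof (intro set_eqI iffI)
  let ?L = "cylinder_labeling A"
  fix k assume "k \<in> A"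
  then have "path_word ?L [] (\<lambda>i. odd (digit k i)) = digit k"
    using path_word_cylinder_labeling[OF A(1), of k "[]"] by (auto simp: parity_cylinder_def)
  then show "k \<in> labeling_spectrum ?L"
    unfolding labeling_spectrum_iff by (intro exI[of _ "\<lambda>i. odd (digit k i)"]) simp
next
  let ?L = "cylinder_labeling A"
  fix k assume "k \<in> labeling_spectrum ?L"
  then obtain p where p: "digit k = path_word ?L [] p"
    by (auto simp: labeling_spectrum_iff)
  then have parity: "odd (digit k n) = p n" for n
    using odd_cylinder_labeling[OF A] by (simp add: path_word_def)
  show "k \<in> A"
  proof (rule ccontr)
    assume "k \<notin> A"
    have "orth k l" if "l \<in> A" for l
    proof -
      have "digit k \<noteq> digit l" using that \<open>k \<notin> A\<close> digits_inject by blast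
      then obtain n where n: "\<And>i. i < n \<Longrightarrow> digit k i = digit l i" "digit k n \<noteq> digit l n"
        by (rule first_difference) blast
      \<comment> \<open>Thus \<open>l\<close> passes through the vertex where it parts from
        \<open>k\<close>. With equal parity at \<open>n\<close>, the label there would be the digit
        of both, contrary to the choice of \<open>n\<close>.\<close>
      have "l \<in> parity_cylinder A (map p [0..<n])"
      proof -
        have "odd (digit l i) = p i" if "i < n" for i
          using n(1)[OF that] parity[of i] by simp
        with that show ?thesis by (simp add: parity_cylinder_def)
      qed
      then have "odd (digit l n) \<noteq> p n"
        using n(2) cylinder_labeling_eq_digit[OF A(1), of l "map p [0..<n]" "p n"] p
        by (auto simp: parity_cylinder_snoc path_word_def)
      with n(1) parity show ?thesis unfolding orth_iff_digits by blast
    qed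
    with A(1) have "k \<in> A" by (rule maximal_orth_memI)
    with \<open>k \<notin> A\<close> show False by blast
  qed
qed

section \<open>From integer frequencies to real ones\<close>

lemma L2_inner_expo_of_int_eq_0_iff:
  "L2_inner mu4 (expo (of_int k)) (expo (of_int l)) = 0 \<longleftrightarrow> orth k l"
proof -
  have "real_of_int k - of_int l = 4 ^ n * (2 * of_int m + 1) \<longleftrightarrow> k - l = 4 ^ n * (2 * m + 1)" for n m
    unfolding of_int_eq_iff[where 'a = real, symmetric] by simp
  then show ?thesis by (simp add: L2_inner_expo_eq_0_iff orth_def)
qed

lemma integer_if_orthogonal_to_integer:
  assumes "L2_inner mu4 (expo l) (expo (of_int k)) = 0"
  shows "l \<in> \<int>"
proof -
  obtain n m where "l - of_int k = 4 ^ n * (2 * of_int m + 1)"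
    using assms unfolding L2_inner_expo_eq_0_iff by blast
  then have "l = of_int (k + 4 ^ n * (2 * m + 1))" by (simp add: algebra_simps)
  then show ?thesis by (metis Ints_of_int)
qed

text \<open>Any real frequency orthogonal to the whole set is orthogonal to the integer
  \<open>k0\<close>, hence an integer, so only integers compete for extending
  \<open>A\<close>.\<close>

lemma maximal_orthogonal_exponentials_of_int_iff:
  assumes "k0 \<in> A"
  shows "maximal_orthogonal_exponentials mu4 (real_of_int ` A) \<longleftrightarrow> maximal_orth A"
proof -
  have orthogonal: "(\<forall>l\<in>real_of_int ` A. \<forall>l'\<in>real_of_int ` A. l \<noteq> l' \<longrightarrow> L2_inner mu4 (expo l) (expo l') = 0)
      \<longleftrightarrow> (\<forall>k\<in>A. \<forall>l\<in>A. k \<noteq> l \<longrightarrow> orth k l)"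
    by (simp add: L2_inner_expo_of_int_eq_0_iff)
  have extendable: "(\<exists>l'. l' \<notin> real_of_int ` A \<and> (\<forall>l\<in>real_of_int ` A. L2_inner mu4 (expo l') (expo l) = 0))
      \<longleftrightarrow> (\<exists>k. k \<notin> A \<and> (\<forall>l\<in>A. orth k l))"
  proof
    assume "\<exists>l'. l' \<notin> real_of_int ` A \<and> (\<forall>l\<in>real_of_int ` A. L2_inner mu4 (expo l') (expo l) = 0)"
    then obtain l' where l': "l' \<notin> real_of_int ` A"
      "\<And>l. l \<in> A \<Longrightarrow> L2_inner mu4 (expo l') (expo (of_int l)) = 0" by blast
    have "l' \<in> \<int>" using l'(2)[OF assms] by (rule integer_if_orthogonal_to_integer)
    then obtain k where "l' = of_int k" by (elim Ints_cases)
    with l' show "\<exists>k. k \<notin> A \<and> (\<forall>l\<in>A. orth k l)"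
      unfolding L2_inner_expo_of_int_eq_0_iff[symmetric] by blast
  next
    assume "\<exists>k. k \<notin> A \<and> (\<forall>l\<in>A. orth k l)"
    then obtain k where "k \<notin> A" "\<forall>l\<in>A. orth k l" by blast
    then show "\<exists>l'. l' \<notin> real_of_int ` A \<and> (\<forall>l\<in>real_of_int ` A. L2_inner mu4 (expo l') (expo l) = 0)"
      by (intro exI[of _ "of_int k"]) (auto simp: L2_inner_expo_of_int_eq_0_iff)
  qed
  show ?thesis
    unfolding maximal_orthogonal_exponentials_def mutually_orthogonal_exponentials_def
      maximal_orth_def orthogonal extendable
    by (intro arg_cong2[where f = "(\<and>)"] refl) blast
qed

theorem theorem3p3:
  fixes \<Lambda> :: "real set"
  assumes "0 \<in> \<Lambda>"
  shows "maximal_orthogonal_exponentials mu4 \<Lambda> \<longleftrightarrow>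
    (\<exists>L. spectral_labeling L \<and> \<Lambda> = real_of_int ` labeling_spectrum L)"
proof
  assume max: "maximal_orthogonal_exponentials mu4 \<Lambda>"
  define A where "A = {k. real_of_int k \<in> \<Lambda>}"
  have "0 \<in> A" using assms by (simp add: A_def)
  \<comment> \<open>Here 0 in \<Lambda> enters: nonzero frequencies are orthogonal to it and are
    therefore integers.\<close>
  have "l \<in> \<int>" if "l \<in> \<Lambda>" for l
  proof (cases "l = 0")
    case False
    then have "L2_inner mu4 (expo l) (expo (of_int 0)) = 0"
      using max that assms
      by (simp add: maximal_orthogonal_exponentials_def mutually_orthogonal_exponentials_def)
    then show ?thesis by (rule integer_if_orthogonal_to_integer)
  qed simp
  then have \<Lambda>: "\<Lambda> = real_of_int ` A"
    by (auto simp: A_def elim!: Ints_cases)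
  with max have "maximal_orth A"
    using maximal_orthogonal_exponentials_of_int_iff[OF \<open>0 \<in> A\<close>] by simp
  moreover have "A \<noteq> {}" using \<open>0 \<in> A\<close> by blast
  ultimately show "\<exists>L. spectral_labeling L \<and> \<Lambda> = real_of_int ` labeling_spectrum L"
    using spectral_cylinder_labeling labeling_spectrum_cylinder_labeling \<Lambda> by metis
next
  assume "\<exists>L. spectral_labeling L \<and> \<Lambda> = real_of_int ` labeling_spectrum L"
  then obtain L where L: "spectral_labeling L" and \<Lambda>: "\<Lambda> = real_of_int ` labeling_spectrum L"
    by blast
  have "0 \<in> labeling_spectrum L" using assms \<Lambda> by auto
  from maximal_orthogonal_exponentials_of_int_iff[OF this] show "maximal_orthogonal_exponentials mu4 \<Lambda>"
    using maximal_orth_labeling_spectrum[OF L] \<Lambda> by simp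
qed

end
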